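(* Suppose $F=\mathbb{F}_q$ and $\lambda\in F$. Let $\pi$ be the probability that a uniformly distributed $A\in F^{n\times n}$ has $C_F(A,\lambda)\neq\{0\}$. Then $\pi\geq q^{-1}$ if $\lambda=0$, and $\pi=1$ if $\lambda=1$. For $\lambda\notin\{0,1\}$, if $n\neq 3$ then $\pi\geq\frac54 q^{-1}$, while if $n=3$ then $\pi\geq\frac76 q^{-1}$.
   Context: Here $\mathbb{F}_q$ is the finite field with $q$ elements, $n$ is a positive integer, and $F^{n\times n}$ is the space of $n\times n$ matrices over $F$. For a field $F$, $A\in F^{n\times n}$ and $\lambda\in F$, the twisted centralizer code is $C_F(A,\lambda)=\{B\in F^{n\times n}\mid AB-\lambda BA=0\}$.
   Formalization: For λ∉{0,1}, the bound π ≥ (5/4)q^{-1} is stated for n ≠ 1, 3 only: when n = 1 one has C_F(A,λ) ≠ {0} iff A = 0, so π = q^{-1} and the bound as written fails. *)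

theory Defs
  imports "HOL-Probability.Probability_Mass_Function" "Jordan_Normal_Form.Matrix"
begin

definition twisted_centralizer :: "nat \<Rightarrow> 'a::field mat \<Rightarrow> 'a \<Rightarrow> 'a mat set" where
  "twisted_centralizer n A lam =
     {B \<in> carrier_mat n n. A * B - lam \<cdot>\<^sub>m (B * A) = 0\<^sub>m n n}"

(* pmf_of_set is the uniform distribution only on finite non-empty sets. *)
lemma finite_carrier_mat: "finite (carrier_mat n m :: 'a::finite mat set)"
proof (rule finite_subset)
  let ?F = "{f. \<forall>x. (x \<in> {..<n} \<times> {..<m} \<longrightarrow> f x \<in> (UNIV :: 'a set)) \<and>
      (x \<notin> {..<n} \<times> {..<m} \<longrightarrow> f x = undefined)}"
  show "carrier_mat n m \<subseteq> mat n m ` ?F"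
  proof
    fix A :: "'a mat"
    assume A: "A \<in> carrier_mat n m"
    have "A = mat n m (\<lambda>x. if x \<in> {..<n} \<times> {..<m} then A $$ x else undefined)"
      using A by (intro eq_matI) auto
    then show "A \<in> mat n m ` ?F"
      by (rule image_eqI[of _ "mat n m"]) auto
  qed
  show "finite (mat n m ` ?F)"
    by (intro finite_imageI finite_set_of_finite_funs) auto
qed

lemma carrier_mat_nonempty: "carrier_mat n m \<noteq> ({} :: 'a::zero mat set)"
  using zero_carrier_mat by blast

definition prob_nonzero_twisted_centralizer :: "nat \<Rightarrow> 'a::{field,finite} \<Rightarrow> real" where
  "prob_nonzero_twisted_centralizer n lam =
     measure_pmf.prob (pmf_of_set (carrier_mat n n))
       {A. twisted_centralizer n A lam \<noteq> {0\<^sub>m n n}}"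

end

theory Submission
  imports Defs "Jordan_Normal_Form.Char_Poly"
begin

text \<open>
  If \<open>b\<close> and \<open>lam * b\<close> are both eigenvalues of \<open>A\<close>, then a right eigenvector \<open>v\<close> for \<open>lam * b\<close>
  and a left eigenvector \<open>w\<close> for \<open>b\<close> give the nonzero matrix \<open>B = v w\<^sup>T\<close> with
  \<open>A B = lam * b * B = lam B A\<close>. So the probability in question is at least the probability
  that the spectrum \<open>K\<close> of a random \<open>A\<close> contains \<open>0\<close> (take \<open>b = 0\<close>) or one of the pairs
  \<open>{b, lam * b}\<close> with \<open>b \<noteq> 0\<close>. For \<open>lam = 1\<close> the identity matrix is always in the centralizer.

  Let \<open>q\<close> be the number of scalars and \<open>s n\<close> the probability that an \<open>n
  \<times> n\<close> matrix is singular. Counting invertible matrices by their first column gives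
  \<open>1 - s n = (1 - 1/q) \<cdots> (1 - 1/q^n)\<close>, hence \<open>s n \<ge> 1/q\<close>, which
  settles \<open>lam = 0\<close>. In general \<open>s n\<close> exceeds \<open>1/q\<close> only by about
  \<open>1/q\<^sup>2\<close>, so for other \<open>lam\<close> the pairs have to contribute the rest.
  There are at least \<open>m\<close> of them, where \<open>m\<close> is about \<open>q/2\<close> (the
  worst case is \<open>lam = -1\<close>, when each pair arises from two values of \<open>b\<close>), and
  each is contained in \<open>K\<close> with probability about \<open>1/q\<^sup>2\<close>. Two different
  pairs, or a pair and \<open>0\<close>, contain at least three scalars, and three given scalars all lie
  in \<open>K\<close> with probability at most \<open>P3\<close>, about \<open>1/q\<^sup>3\<close>. With
  \<open>P2\<close> a lower bound for the probability that two given scalars lie in \<open>K\<close>,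
  inclusion-exclusion bounds the probability below by \<open>s n + m (P2 - P3) - m (m - 1) / 2 *
  P3\<close> (\<open>prob_nonzero_ge_inclusion_exclusion\<close>). To leading order this is \<open>(1 +
  1/2 - 1/8) / q\<close>, which exceeds \<open>(1 + 1/4) / q\<close>.

  The bounds \<open>P2\<close> and \<open>P3\<close> come from double counting pairs of a matrix and an eigenvector for a
  scalar \<open>a\<close>. All nonzero vectors are equivalent under conjugation, and a matrix that has the first
  unit vector as eigenvector is block upper triangular with a uniformly random lower right block
  \<open>D\<close> and characteristic polynomial \<open>(X - a)\<close> times that of \<open>D\<close> (\<open>card_fixed_eigenvector\<close>).
  A matrix with eigenvalue \<open>a\<close> has at least \<open>q - 1\<close> eigenvectors for \<open>a\<close>, and exactly \<open>q - 1\<close> if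
  \<open>a\<close> is a simple root. Hence prescribing one more eigenvalue costs a factor of at most \<open>1 / (q - 1)\<close>
  (\<open>root_prob_insert_le\<close>), and counting only those matrices in which \<open>a\<close> is simple gives a lower
  bound of the same size (\<open>root_prob_pair_ge\<close>).

  For \<open>n = 2\<close> three distinct eigenvalues are impossible, and for \<open>q = 3\<close>, \<open>n \<ge> 3\<close> the singular matrices
  alone suffice. In the remaining cases the estimates are uniform in \<open>n\<close> and leave a polynomial
  inequality in \<open>q \<ge> 4\<close>. The bound \<open>5/4\<close> comes out for \<open>n = 3\<close> as well, and implies \<open>7/6\<close>.
\<close>

unbundle no vec_syntax and no inner_syntax

section \<open>Rank-one elements of the twisted centralizer\<close>

definition outer_prod :: "'a::times vec \<Rightarrow> 'a vec \<Rightarrow> 'a mat" where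
  "outer_prod v w = mat (dim_vec v) (dim_vec w) (\<lambda>(i, j). v $ i * w $ j)"

lemma outer_prod_carrier [simp]:
  "v \<in> carrier_vec n \<Longrightarrow> w \<in> carrier_vec m \<Longrightarrow> outer_prod v w \<in> carrier_mat n m"
  by (auto simp: outer_prod_def)

lemma outer_prod_index [simp]:
  "i < dim_vec v \<Longrightarrow> j < dim_vec w \<Longrightarrow> outer_prod v w $$ (i, j) = v $ i * w $ j"
  "dim_row (outer_prod v w) = dim_vec v" "dim_col (outer_prod v w) = dim_vec w"
  by (auto simp: outer_prod_def)

lemma mult_outer_prod:
  fixes A :: "'a::comm_ring_1 mat"
  assumes "A \<in> carrier_mat m n" "v \<in> carrier_vec n"
  shows "A * outer_prod v w = outer_prod (A *\<^sub>v v) w"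
  using assms
  by (intro eq_matI) (auto simp: scalar_prod_def sum_distrib_right mult.assoc intro!: sum.cong)

lemma outer_prod_mult:
  fixes A :: "'a::comm_ring_1 mat"
  assumes "A \<in> carrier_mat n m" "w \<in> carrier_vec n"
  shows "outer_prod v w * A = outer_prod v (transpose_mat A *\<^sub>v w)"
  using assms
  by (intro eq_matI)
     (auto simp: scalar_prod_def sum_distrib_left mult_ac intro!: sum.cong)

lemma outer_prod_mult_vec:
  fixes v :: "'a::comm_ring_1 vec"
  assumes "w \<in> carrier_vec n" "x \<in> carrier_vec n"
  shows "outer_prod v w *\<^sub>v x = (w \<bullet> x) \<cdot>\<^sub>v v"
  using assms
  by (intro eq_vecI)
     (auto simp: scalar_prod_def sum_distrib_left sum_distrib_right mult_ac intro!: sum.cong)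

lemma outer_prod_neq_0:
  fixes v :: "'a::idom vec"
  assumes "v \<in> carrier_vec n" "v \<noteq> 0\<^sub>v n" "w \<in> carrier_vec m" "w \<noteq> 0\<^sub>v m"
  shows "outer_prod v w \<noteq> 0\<^sub>m n m"
proof -
  obtain i where i: "i < n" "v $ i \<noteq> 0" using assms(1,2) by (metis carrier_vecD eq_vecI index_zero_vec)
  obtain j where j: "j < m" "w $ j \<noteq> 0" using assms(3,4) by (metis carrier_vecD eq_vecI index_zero_vec)
  have "outer_prod v w $$ (i, j) \<noteq> 0" using i j assms by auto
  with i j show ?thesis by auto
qed

text \<open>The witness is \<open>v w\<^sup>T\<close> for a right eigenvector \<open>v\<close> and a left eigenvector \<open>w\<close>: it satisfies
  \<open>A (v w\<^sup>T) = lam * b * v w\<^sup>T\<close> and \<open>(v w\<^sup>T) A = b * v w\<^sup>T\<close>. For \<open>b = 0\<close> this covers singular matrices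
  with any \<open>lam\<close>.\<close>

lemma twisted_centralizer_nonzero_of_roots:
  fixes A :: "'a::field mat"
  assumes A: "A \<in> carrier_mat n n"
    and b: "poly (char_poly A) b = 0" and lb: "poly (char_poly A) (lam * b) = 0"
  shows "twisted_centralizer n A lam \<noteq> {0\<^sub>m n n}"
proof -
  have "eigenvalue A (lam * b)" using eigenvalue_root_char_poly[OF A] lb by blast
  then obtain v where v: "v \<in> carrier_vec n" "v \<noteq> 0\<^sub>v n" "A *\<^sub>v v = (lam * b) \<cdot>\<^sub>v v"
    using A by (auto simp: eigenvalue_def eigenvector_def)
  have At: "transpose_mat A \<in> carrier_mat n n" using A by simp
  have "eigenvalue (transpose_mat A) b"
    using eigenvalue_root_char_poly[OF At] b A by simp
  then obtain w where w: "w \<in> carrier_vec n" "w \<noteq> 0\<^sub>v n" "transpose_mat A *\<^sub>v w = b \<cdot>\<^sub>v w"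
    using A by (auto simp: eigenvalue_def eigenvector_def)
  let ?B = "outer_prod v w"
  have "A * ?B = outer_prod ((lam * b) \<cdot>\<^sub>v v) w" "?B * A = outer_prod v (b \<cdot>\<^sub>v w)"
    using mult_outer_prod[OF A v(1)] outer_prod_mult[OF A w(1)] v w by auto
  then have "A * ?B - lam \<cdot>\<^sub>m (?B * A) = 0\<^sub>m n n"
    using v w by (intro eq_matI) auto
  then have "?B \<in> twisted_centralizer n A lam" using v w by (simp add: twisted_centralizer_def)
  then show ?thesis using outer_prod_neq_0[OF v(1,2) w(1,2)] by auto
qed

lemma twisted_centralizer_1_nonzero:
  fixes A :: "'a::field mat"
  assumes A: "A \<in> carrier_mat n n" and n: "n \<ge> 1"
  shows "twisted_centralizer n A 1 \<noteq> {0\<^sub>m n n}"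
proof -
  have "A * 1\<^sub>m n - 1 \<cdot>\<^sub>m (1\<^sub>m n * A) = 0\<^sub>m n n" using A by (intro eq_matI) auto
  then have "1\<^sub>m n \<in> twisted_centralizer n A 1" by (simp add: twisted_centralizer_def)
  moreover have "(1\<^sub>m n :: 'a mat) $$ (0,0) \<noteq> 0\<^sub>m n n $$ (0,0)" using n by simp
  ultimately show ?thesis by auto
qed

section \<open>Moving a vector to the first unit vector\<close>

text \<open>The Sherman-Morrison formula for the inverse of a rank-one perturbation of the identity.\<close>

lemma inverse_one_plus_outer_prod:
  fixes u :: "'a::field vec"
  assumes u: "u \<in> carrier_vec n" and w: "w \<in> carrier_vec n" and c: "1 + w \<bullet> u \<noteq> 0"
  shows "(1\<^sub>m n + outer_prod u w) * (1\<^sub>m n + outer_prod ((- 1 / (1 + w \<bullet> u)) \<cdot>\<^sub>v u) w) = 1\<^sub>m n"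
proof -
  define d where "d = - 1 / (1 + w \<bullet> u)"
  have d: "d + 1 + (w \<bullet> u) * d = 0" using c by (simp add: d_def field_simps)
  have du: "d \<cdot>\<^sub>v u \<in> carrier_vec n" using u by simp
  let ?U = "outer_prod u w" and ?D = "outer_prod (d \<cdot>\<^sub>v u) w"
  have U: "?U \<in> carrier_mat n n" and D: "?D \<in> carrier_mat n n" using u w by auto
  have "?U * ?D = outer_prod ((w \<bullet> (d \<cdot>\<^sub>v u)) \<cdot>\<^sub>v u) w"
    by (simp add: mult_outer_prod[OF U du] outer_prod_mult_vec[OF w du])
  also have "w \<bullet> (d \<cdot>\<^sub>v u) = (w \<bullet> u) * d" using u w by simp
  finally have UD: "?U * ?D = outer_prod (((w \<bullet> u) * d) \<cdot>\<^sub>v u) w" .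
  have "(1\<^sub>m n + ?U) * (1\<^sub>m n + ?D) = 1\<^sub>m n * (1\<^sub>m n + ?D) + ?U * (1\<^sub>m n + ?D)"
    using U D by (intro add_mult_distrib_mat[of _ n n _ _ n]) auto
  also have "1\<^sub>m n * (1\<^sub>m n + ?D) = 1\<^sub>m n + ?D"
    using D by (intro left_mult_one_mat[of _ n n]) auto
  also have "?U * (1\<^sub>m n + ?D) = ?U * 1\<^sub>m n + ?U * ?D"
    using U D by (intro mult_add_distrib_mat[of _ n n _ n]) auto
  also have "?U * 1\<^sub>m n = ?U"
    using U by (intro right_mult_one_mat[of _ n n]) auto
  also have "1\<^sub>m n + ?D + (?U + ?U * ?D) = 1\<^sub>m n"
  proof (intro eq_matI)
    fix i j assume ij: "i < dim_row (1\<^sub>m n :: 'a mat)" "j < dim_col (1\<^sub>m n :: 'a mat)"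
    have "d * u $ i * w $ j + (u $ i * w $ j + (w \<bullet> u) * d * u $ i * w $ j)
        = (d + 1 + (w \<bullet> u) * d) * (u $ i * w $ j)"
      by (simp add: algebra_simps)
    then show "(1\<^sub>m n + ?D + (?U + ?U * ?D)) $$ (i, j) = 1\<^sub>m n $$ (i, j)"
      using ij u w d unfolding UD by (auto simp: mult.assoc)
  qed (use u w in auto)
  finally show ?thesis unfolding d_def .
qed

text \<open>Conjugation by \<open>P\<close> moves the first unit vector \<open>e\<close> to \<open>v\<close>. A rank-one perturbation of the identity
  suffices: \<open>P = 1 + (v - e) w\<^sup>T\<close> maps \<open>e\<close> to \<open>v\<close> as soon as \<open>w \<bullet> e = 1\<close>, and it is invertible
  as soon as \<open>w \<bullet> v \<noteq> 0\<close>.\<close>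

lemma exists_invertible_first_column:
  fixes v :: "'a::field vec"
  assumes v: "v \<in> carrier_vec (Suc m)" "v \<noteq> 0\<^sub>v (Suc m)"
  obtains P Q where "P \<in> carrier_mat (Suc m) (Suc m)" "Q \<in> carrier_mat (Suc m) (Suc m)"
    "P * Q = 1\<^sub>m (Suc m)" "Q * P = 1\<^sub>m (Suc m)" "P *\<^sub>v unit_vec (Suc m) 0 = v"
proof -
  let ?n = "Suc m" and ?e = "unit_vec (Suc m) 0 :: 'a vec"
  have e: "?e \<in> carrier_vec ?n" by simp
  obtain w where w: "w \<in> carrier_vec ?n" "w \<bullet> ?e = 1" "w \<bullet> v \<noteq> 0"
  proof (cases "v $ 0 = 0")
    case False
    \<comment> \<open>If the first entry of \<open>v\<close> is nonzero, \<open>w = e\<close> works; otherwise another unit vector is added.\<close>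
    show ?thesis by (rule that[of ?e]) (use v False in auto)
  next
    case True
    obtain i where i: "i < ?n" "v $ i \<noteq> 0" using v by (metis carrier_vecD eq_vecI index_zero_vec)
    let ?w = "?e + unit_vec ?n i"
    have "?w \<bullet> ?e = ?e \<bullet> ?e + unit_vec ?n i \<bullet> ?e"
      by (rule add_scalar_prod_distrib[of _ ?n]) auto
    moreover have "?w \<bullet> v = ?e \<bullet> v + unit_vec ?n i \<bullet> v"
      by (rule add_scalar_prod_distrib[of _ ?n]) (use v in auto)
    ultimately show ?thesis using i v True by (intro that[of ?w]) (auto intro: gr0I)
  qed
  let ?u = "v - ?e"
  have u: "?u \<in> carrier_vec ?n" using v by simp
  have wu: "1 + w \<bullet> ?u = w \<bullet> v"
    using w v by (simp add: scalar_prod_minus_distrib[of _ ?n])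
  let ?P = "1\<^sub>m ?n + outer_prod ?u w"
  let ?Q = "1\<^sub>m ?n + outer_prod ((- 1 / (1 + w \<bullet> ?u)) \<cdot>\<^sub>v ?u) w"
  have P: "?P \<in> carrier_mat ?n ?n" and Q: "?Q \<in> carrier_mat ?n ?n" using u w by auto
  have PQ: "?P * ?Q = 1\<^sub>m ?n" using inverse_one_plus_outer_prod[OF u w(1)] wu w by simp
  have "?P *\<^sub>v ?e = 1\<^sub>m ?n *\<^sub>v ?e + outer_prod ?u w *\<^sub>v ?e"
    by (rule add_mult_distrib_mat_vec[of _ ?n ?n]) (use u w in auto)
  also have "\<dots> = ?e + ?u" using outer_prod_mult_vec[OF w(1) e] w(2) u by simp
  also have "\<dots> = v" using v by (intro eq_vecI) auto
  finally show ?thesis using that[OF P Q PQ mat_mult_left_right_inverse[OF P Q PQ]] by blast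
qed

definition block_upper :: "nat \<Rightarrow> 'a::semiring_1 \<Rightarrow> 'a mat \<Rightarrow> 'a mat \<Rightarrow> 'a mat" where
  "block_upper m a R D = four_block_mat (a \<cdot>\<^sub>m 1\<^sub>m 1) R (0\<^sub>m m 1) D"

lemma block_upper_carrier [simp]:
  "R \<in> carrier_mat 1 m \<Longrightarrow> D \<in> carrier_mat m m \<Longrightarrow> block_upper m a R D \<in> carrier_mat (Suc m) (Suc m)"
  by (auto simp: block_upper_def)

lemma char_poly_block_upper:
  fixes a :: "'a::field"
  assumes "R \<in> carrier_mat 1 m" "D \<in> carrier_mat m m"
  shows "char_poly (block_upper m a R D) = [:-a, 1:] * char_poly D"
proof -
  have "char_poly (a \<cdot>\<^sub>m 1\<^sub>m 1) = [:-a, 1:]"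
    by (simp add: char_poly_defs det_def sign_def)
  then show ?thesis unfolding block_upper_def
    using char_poly_four_block_zeros_col[of "a \<cdot>\<^sub>m 1\<^sub>m 1" R m D] assms by simp
qed

lemma det_block_upper:
  fixes a :: "'a::field"
  assumes "R \<in> carrier_mat 1 m" "D \<in> carrier_mat m m"
  shows "det (block_upper m a R D) = a * det D"
proof -
  have "det (a \<cdot>\<^sub>m 1\<^sub>m 1) = a" by simp
  then show ?thesis unfolding block_upper_def
    using det_four_block_mat_lower_left_zero_col[of "a \<cdot>\<^sub>m 1\<^sub>m 1" R m "0\<^sub>m m 1" D] assms by simp
qed

lemma mult_unit_vec_0:
  fixes A :: "'a::comm_ring_1 mat"
  assumes "A \<in> carrier_mat n (Suc m)"
  shows "A *\<^sub>v unit_vec (Suc m) 0 = col A 0"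
  using assms by (intro eq_vecI) auto

lemma first_vector_eigen_eq_block_upper:
  fixes a :: "'a::field"
  shows "{A \<in> carrier_mat (Suc m) (Suc m). A *\<^sub>v unit_vec (Suc m) 0 = a \<cdot>\<^sub>v unit_vec (Suc m) 0}
    = (\<lambda>(R, D). block_upper m a R D) ` (carrier_mat 1 m \<times> carrier_mat m m)" (is "?L = ?R")
proof
  show "?L \<subseteq> ?R"
  proof
    fix A assume "A \<in> ?L"
    then have A: "A \<in> carrier_mat (Suc m) (Suc m)" and
      e: "col A 0 = a \<cdot>\<^sub>v unit_vec (Suc m) 0" by (auto simp: mult_unit_vec_0)
    let ?r = "mat 1 m (\<lambda>(i, j). A $$ (0, Suc j))" and ?D = "mat m m (\<lambda>(i, j). A $$ (Suc i, Suc j))"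
    have c: "A $$ (i, 0) = (if i = 0 then a else 0)" if "i < Suc m" for i
      using arg_cong[OF e, of "\<lambda>v. v $ i"] that A by (auto simp: unit_vec_def split: if_splits)
    have "A = block_upper m a ?r ?D"
      using A by (intro eq_matI) (auto simp: block_upper_def c)
    then show "A \<in> ?R" by (intro image_eqI[of _ _ "(?r, ?D)"]) auto
  qed
  show "?R \<subseteq> ?L"
  proof clarify
    fix R D :: "'a mat" assume RD: "R \<in> carrier_mat 1 m" "D \<in> carrier_mat m m"
    then have c: "block_upper m a R D \<in> carrier_mat (Suc m) (Suc m)" by simp
    have "col (block_upper m a R D) 0 = a \<cdot>\<^sub>v unit_vec (Suc m) 0"
      using RD by (intro eq_vecI) (auto simp: block_upper_def unit_vec_def)
    with c show "block_upper m a R D \<in> carrier_mat (Suc m) (Suc m) \<and>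
        block_upper m a R D *\<^sub>v unit_vec (Suc m) 0 = a \<cdot>\<^sub>v unit_vec (Suc m) 0"
      using mult_unit_vec_0[OF c] by simp
  qed
qed

lemma inj_on_block_upper:
  "inj_on (\<lambda>(R, D). block_upper m a R D) (carrier_mat 1 m \<times> carrier_mat m m)"
proof (rule inj_onI, clarify)
  fix R D R' D' :: "'a mat"
  assume c: "R \<in> carrier_mat 1 m" "D \<in> carrier_mat m m" "R' \<in> carrier_mat 1 m" "D' \<in> carrier_mat m m"
    and eq: "block_upper m a R D = block_upper m a R' D'"
  have "R $$ (i, j) = R' $$ (i, j)" if "i < 1" "j < m" for i j
    using arg_cong[OF eq, of "\<lambda>A. A $$ (0, Suc j)"] c that by (simp add: block_upper_def)
  moreover have "D $$ (i, j) = D' $$ (i, j)" if "i < m" "j < m" for i j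
    using arg_cong[OF eq, of "\<lambda>A. A $$ (Suc i, Suc j)"] c that by (simp add: block_upper_def)
  ultimately show "R = R' \<and> D = D'" using c by (intro conjI eq_matI) auto
qed

text \<open>Since \<open>a\<close> is not an eigenvalue of \<open>D\<close>, the lower part of an eigenvector for \<open>a\<close> vanishes. This is
  the bound of the geometric by the algebraic multiplicity, for a simple root.\<close>

lemma eigenvector_block_upper:
  fixes a :: "'a::field"
  assumes R: "R \<in> carrier_mat 1 m" and D: "D \<in> carrier_mat m m" and na: "poly (char_poly D) a \<noteq> 0"
    and w: "w \<in> carrier_vec (Suc m)" "block_upper m a R D *\<^sub>v w = a \<cdot>\<^sub>v w"
  shows "w = (w $ 0) \<cdot>\<^sub>v unit_vec (Suc m) 0"
proof -
  define w0 w' where "w0 = vec 1 (\<lambda>i. w $ 0)" and "w' = vec m (\<lambda>i. w $ Suc i)"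
  have ws: "w = w0 @\<^sub>v w'" using w(1) by (intro eq_vecI) (auto simp: w0_def w'_def)
  have "block_upper m a R D *\<^sub>v w =
      ((a \<cdot>\<^sub>m 1\<^sub>m 1) *\<^sub>v w0 + R *\<^sub>v w') @\<^sub>v (0\<^sub>m m 1 *\<^sub>v w0 + D *\<^sub>v w')"
    unfolding ws block_upper_def
    by (rule four_block_mat_mult_vec) (use R D in \<open>auto simp: w0_def w'_def\<close>)
  moreover have "a \<cdot>\<^sub>v w = (a \<cdot>\<^sub>v w0) @\<^sub>v (a \<cdot>\<^sub>v w')" unfolding ws
    by (intro eq_vecI) auto
  ultimately have "(0\<^sub>m m 1 *\<^sub>v w0 + D *\<^sub>v w') = a \<cdot>\<^sub>v w'"
    using w(2) append_vec_eq[of "a \<cdot>\<^sub>v w0" 1 "(a \<cdot>\<^sub>m 1\<^sub>m 1) *\<^sub>v w0 + R *\<^sub>v w'"] R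
    by (metis carrier_vecI dim_mult_mat_vec dim_vec index_add_vec(2) index_smult_vec(2) w0_def carrier_matD(1))
  moreover have "0\<^sub>m m 1 *\<^sub>v w0 + D *\<^sub>v w' = D *\<^sub>v w'"
    using D by (intro eq_vecI) (auto simp: w0_def w'_def)
  ultimately have "D *\<^sub>v w' = a \<cdot>\<^sub>v w'" by simp
  moreover have "\<not> eigenvalue D a" using na eigenvalue_root_char_poly[OF D] by blast
  moreover have "w' \<in> carrier_vec m" by (simp add: w'_def)
  ultimately have "w' = 0\<^sub>v m" using D unfolding eigenvalue_def eigenvector_def by auto
  then have "w $ Suc i = 0" if "i < m" for i
    using that by (metis index_vec index_zero_vec(1) w'_def)
  then show ?thesis using w(1) by (intro eq_vecI) (auto simp: unit_vec_def gr0_conv_Suc)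
qed

section \<open>Counting matrices with a prescribed eigenvector\<close>

lemma card_carrier_mat: "card (carrier_mat n m :: 'a::finite mat set) = CARD('a) ^ (n * m)"
proof -
  let ?I = "{..<n} \<times> {..<m}"
  have "bij_betw (\<lambda>A. restrict (\<lambda>x. A $$ x) ?I) (carrier_mat n m :: 'a mat set) (PiE ?I (\<lambda>_. UNIV))"
  proof (rule bij_betw_byWitness[where f' = "mat n m"])
    show "\<forall>A\<in>carrier_mat n m. mat n m (restrict (\<lambda>x. A $$ x) ?I) = (A :: 'a mat)"
      by (auto intro!: eq_matI)
    show "\<forall>f\<in>PiE ?I (\<lambda>_. UNIV :: 'a set). restrict (\<lambda>x. mat n m f $$ x) ?I = f"
      by (auto simp: fun_eq_iff PiE_def extensional_def restrict_def)
    show "(\<lambda>A. restrict (\<lambda>x. A $$ x) ?I) ` carrier_mat n m \<subseteq> PiE ?I (\<lambda>_. UNIV :: 'a set)"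
      by (intro image_subsetI restrict_PiE_iff[THEN iffD2]) simp
  qed auto
  then have "card (carrier_mat n m :: 'a mat set) = card (PiE ?I (\<lambda>_. UNIV :: 'a set))"
    by (rule bij_betw_same_card)
  also have "\<dots> = CARD('a) ^ (n * m)" by (simp add: card_PiE)
  finally show ?thesis .
qed

lemma finite_carrier_vec_and_card:
  shows "finite (carrier_vec n :: 'a::finite vec set)"
    and "card (carrier_vec n :: 'a vec set) = CARD('a) ^ n"
proof -
  have b: "bij_betw (\<lambda>A. col A 0) (carrier_mat n 1) (carrier_vec n :: 'a vec set)"
  proof (rule bij_betw_byWitness[where f' = "\<lambda>v. mat n 1 (\<lambda>(i, j). v $ i)"])
    show "\<forall>A\<in>carrier_mat n 1. mat n 1 (\<lambda>(i, j). col A 0 $ i) = (A :: 'a mat)"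
      by (auto intro!: eq_matI)
  qed (auto intro!: eq_vecI)
  then show "finite (carrier_vec n :: 'a vec set)"
    using bij_betw_finite finite_carrier_mat by blast
  show "card (carrier_vec n :: 'a vec set) = CARD('a) ^ n"
    using bij_betw_same_card[OF b] by (simp add: card_carrier_mat)
qed

lemma card_nonzero_vecs:
  "card (carrier_vec n - {0\<^sub>v n} :: 'a::{finite,zero} vec set) = CARD('a) ^ n - 1"
  by (simp add: card_Diff_singleton finite_carrier_vec_and_card)

text \<open>The upper right block \<open>R\<close> of such a matrix is arbitrary and contributes the factor \<open>q^m\<close>.\<close>

lemma card_first_vector_eigen:
  fixes a :: "'a::{field,finite}"
  assumes "\<And>R D. R \<in> carrier_mat 1 m \<Longrightarrow> D \<in> carrier_mat m m \<Longrightarrow> S (block_upper m a R D) = S' D"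
  shows "card {A \<in> carrier_mat (Suc m) (Suc m).
        A *\<^sub>v unit_vec (Suc m) 0 = a \<cdot>\<^sub>v unit_vec (Suc m) 0 \<and> S A}
    = CARD('a) ^ m * card {D \<in> carrier_mat m m. S' D}" (is "card ?L = _")
proof -
  let ?f = "\<lambda>(R, D). block_upper m a R D"
  have "?L = {A \<in> ?f ` (carrier_mat 1 m \<times> carrier_mat m m). S A}"
    unfolding first_vector_eigen_eq_block_upper[symmetric] by auto
  also have "\<dots> = ?f ` (carrier_mat 1 m \<times> {D \<in> carrier_mat m m. S' D})"
    using assms by auto
  finally have "card ?L = card (carrier_mat 1 m \<times> {D \<in> carrier_mat m m. S' D} :: ('a mat \<times> 'a mat) set)"
    by (simp, intro card_image inj_on_subset[OF inj_on_block_upper]) auto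
  then show ?thesis by (simp add: card_cartesian_product card_carrier_mat)
qed

text \<open>The right-hand side does not depend on \<open>v\<close>: conjugation moves \<open>v\<close> to the first unit vector
  without changing the characteristic polynomial, and there the block form applies. Properties are
  stated through the characteristic polynomial precisely to be invariant under this.\<close>

lemma card_fixed_eigenvector:
  fixes a :: "'a::{field,finite}"
  assumes v: "v \<in> carrier_vec (Suc m)" "v \<noteq> 0\<^sub>v (Suc m)"
  shows "card {A \<in> carrier_mat (Suc m) (Suc m). A *\<^sub>v v = a \<cdot>\<^sub>v v \<and> S (char_poly A)}
    = CARD('a) ^ m * card {D \<in> carrier_mat m m. S ([:-a, 1:] * char_poly D)}"
proof -
  let ?n = "Suc m" and ?e = "unit_vec (Suc m) 0 :: 'a vec"
  obtain P Q where P: "P \<in> carrier_mat ?n ?n" and Q: "Q \<in> carrier_mat ?n ?n"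
    and PQ: "P * Q = 1\<^sub>m ?n" and QP: "Q * P = 1\<^sub>m ?n" and Pe: "P *\<^sub>v ?e = v"
    using exists_invertible_first_column[OF v] by metis
  have e: "?e \<in> carrier_vec ?n" by simp
  have Qv: "Q *\<^sub>v v = ?e"
    unfolding Pe[symmetric] assoc_mult_mat_vec[OF Q P e, symmetric] QP by simp
  let ?X = "\<lambda>v. {A \<in> carrier_mat ?n ?n. A *\<^sub>v v = a \<cdot>\<^sub>v v \<and> S (char_poly A)}"
  have conj: "P' * A * Q' \<in> ?X v'"
    if A: "A \<in> ?X u" and PQ': "P' \<in> carrier_mat ?n ?n" "Q' \<in> carrier_mat ?n ?n"
      "P' * Q' = 1\<^sub>m ?n" "Q' * P' = 1\<^sub>m ?n" and u: "u \<in> carrier_vec ?n" "P' *\<^sub>v u = v'" for A P' Q' u v'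
  proof -
    from A have A': "A \<in> carrier_mat ?n ?n" and Au: "A *\<^sub>v u = a \<cdot>\<^sub>v u" and S: "S (char_poly A)" by auto
    have v': "v' \<in> carrier_vec ?n" using u PQ' by auto
    have "similar_mat (P' * A * Q') A" unfolding similar_mat_def
      by (rule exI[of _ P'], rule exI[of _ Q'], rule similar_mat_witI[OF PQ'(3,4) refl]) (use PQ' A' in auto)
    then have "char_poly (P' * A * Q') = char_poly A" by (rule char_poly_similar)
    moreover have "Q' *\<^sub>v v' = u"
      unfolding u(2)[symmetric] assoc_mult_mat_vec[OF PQ'(2,1) u(1), symmetric] PQ' using u(1) by simp
    then have "(P' * A * Q') *\<^sub>v v' = P' *\<^sub>v (a \<cdot>\<^sub>v u)"
      using PQ' A' v' Au by (simp add: assoc_mult_mat_vec[of _ ?n ?n _ ?n])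
    then have "(P' * A * Q') *\<^sub>v v' = a \<cdot>\<^sub>v v'"
      using mult_mat_vec[OF PQ'(1) u(1)] u(2) by simp
    ultimately show ?thesis using S PQ' A' by simp
  qed
  have cancel: "P' * (Q' * A * P') * Q' = A"
    if "A \<in> carrier_mat ?n ?n" "P' \<in> carrier_mat ?n ?n" "Q' \<in> carrier_mat ?n ?n"
      "P' * Q' = 1\<^sub>m ?n" for A P' Q' :: "'a mat"
  proof -
    have "P' * (Q' * A * P') * Q' = (P' * Q') * A * (P' * Q')"
      using that(1-3) by (simp add: assoc_mult_mat[of _ ?n ?n _ ?n _ ?n])
    then show ?thesis using that by simp
  qed
  have "bij_betw (\<lambda>A. P * A * Q) (?X ?e) (?X v)"
  proof (rule bij_betw_byWitness[where f' = "\<lambda>A. Q * A * P"])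
    show "\<forall>A\<in>?X ?e. Q * (P * A * Q) * P = A" using cancel[OF _ Q P QP] by blast
    show "\<forall>A\<in>?X v. P * (Q * A * P) * Q = A" using cancel[OF _ P Q PQ] by blast
    show "(\<lambda>A. P * A * Q) ` ?X ?e \<subseteq> ?X v" using conj[OF _ P Q PQ QP e Pe] by blast
    show "(\<lambda>A. Q * A * P) ` ?X v \<subseteq> ?X ?e" using conj[OF _ Q P QP PQ v(1) Qv] by blast
  qed
  then have "card (?X v) = card (?X ?e)" by (simp add: bij_betw_same_card)
  also have "\<dots> = CARD('a) ^ m * card {D \<in> carrier_mat m m. S ([:-a, 1:] * char_poly D)}"
    by (rule card_first_vector_eigen) (simp only: char_poly_block_upper)
  finally show ?thesis .
qed

text \<open>Left multiplication with an invertible matrix makes all first columns equally frequent among the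
  nonsingular matrices; for the first column \<open>e\<close> the block form with \<open>a = 1\<close> applies.\<close>

lemma card_nonsingular_fixed_image:
  fixes v :: "'a::{field,finite} vec"
  assumes v: "v \<in> carrier_vec (Suc m)" "v \<noteq> 0\<^sub>v (Suc m)"
  shows "card {A \<in> carrier_mat (Suc m) (Suc m). A *\<^sub>v unit_vec (Suc m) 0 = v \<and> det A \<noteq> 0}
    = CARD('a) ^ m * card {D \<in> carrier_mat m m. det D \<noteq> (0::'a)}"
proof -
  let ?n = "Suc m" and ?e = "unit_vec (Suc m) 0 :: 'a vec"
  obtain P Q where P: "P \<in> carrier_mat ?n ?n" and Q: "Q \<in> carrier_mat ?n ?n"
    and PQ: "P * Q = 1\<^sub>m ?n" and QP: "Q * P = 1\<^sub>m ?n" and Pe: "P *\<^sub>v ?e = v"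
    using exists_invertible_first_column[OF v] by metis
  have e: "?e \<in> carrier_vec ?n" by simp
  have Qv: "Q *\<^sub>v v = ?e"
    unfolding Pe[symmetric] assoc_mult_mat_vec[OF Q P e, symmetric] QP by simp
  have "det P * det Q = 1" using det_mult[OF P Q] PQ by simp
  then have dP: "det P \<noteq> 0" and dQ: "det Q \<noteq> 0" by auto
  let ?X = "\<lambda>v. {A \<in> carrier_mat ?n ?n. A *\<^sub>v ?e = v \<and> det A \<noteq> 0}"
  have "bij_betw (\<lambda>A. P * A) (?X ?e) (?X v)"
  proof (rule bij_betw_byWitness[where f' = "\<lambda>A. Q * A"])
    show "\<forall>A\<in>?X ?e. Q * (P * A) = A"
      using P Q QP by (auto simp: assoc_mult_mat[of _ ?n ?n _ ?n _ ?n, symmetric])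
    show "\<forall>A\<in>?X v. P * (Q * A) = A"
      using P Q PQ by (auto simp: assoc_mult_mat[of _ ?n ?n _ ?n _ ?n, symmetric])
    show "(\<lambda>A. P * A) ` ?X ?e \<subseteq> ?X v"
      using P Pe dP by (auto simp: det_mult[OF P] assoc_mult_mat_vec[OF P _ e])
    show "(\<lambda>A. Q * A) ` ?X v \<subseteq> ?X ?e"
      using Q Qv dQ by (auto simp: det_mult[OF Q] assoc_mult_mat_vec[OF Q _ e])
  qed
  then have "card (?X v) = card (?X (1 \<cdot>\<^sub>v ?e))" by (simp add: bij_betw_same_card)
  also have "\<dots> = CARD('a) ^ m * card {D \<in> carrier_mat m m. det D \<noteq> (0::'a)}"
    by (rule card_first_vector_eigen) (simp only: det_block_upper mult_1)
  finally show ?thesis .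
qed

lemma card_nonsingular_Suc:
  "card {A \<in> carrier_mat (Suc m) (Suc m). det A \<noteq> (0::'a::{field,finite})}
    = (CARD('a) ^ Suc m - 1) * CARD('a) ^ m * card {D \<in> carrier_mat m m. det D \<noteq> (0::'a)}"
proof -
  let ?n = "Suc m" and ?e = "unit_vec (Suc m) 0 :: 'a vec"
  let ?V = "carrier_vec ?n - {0\<^sub>v ?n} :: 'a vec set"
  let ?X = "\<lambda>v. {A \<in> carrier_mat ?n ?n. A *\<^sub>v ?e = v \<and> det A \<noteq> 0}"
  have "A *\<^sub>v ?e \<in> ?V" if A: "A \<in> carrier_mat ?n ?n" "det A \<noteq> 0" for A
  proof -
    have "?e \<in> carrier_vec ?n" "?e \<noteq> 0\<^sub>v ?n" by auto
    then have "A *\<^sub>v ?e \<noteq> 0\<^sub>v ?n" using det_0_iff_vec_prod_zero_field[OF A(1)] A(2) by blast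
    then show ?thesis using A by simp
  qed
  then have "{A \<in> carrier_mat ?n ?n. det A \<noteq> (0::'a)} = (\<Union>v\<in>?V. ?X v)" by auto
  also have "card \<dots> = (\<Sum>v\<in>?V. card (?X v))"
    by (rule card_UN_disjoint)
       (auto simp: finite_carrier_vec_and_card intro: finite_subset[OF _ finite_carrier_mat])
  also have "\<dots> = (\<Sum>v\<in>?V. CARD('a) ^ m * card {D \<in> carrier_mat m m. det D \<noteq> (0::'a)})"
    by (intro sum.cong card_nonsingular_fixed_image) auto
  finally show ?thesis by (simp add: card_nonzero_vecs del: power_Suc)
qed

text \<open>Double counting of the pairs of a matrix and one of its eigenvectors for \<open>a\<close>.\<close>

lemma sum_card_eigenvectors:
  fixes a :: "'a::{field,finite}"
  shows "(\<Sum>A\<in>{A \<in> carrier_mat (Suc m) (Suc m). S (char_poly A)}.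
        card {v \<in> carrier_vec (Suc m) - {0\<^sub>v (Suc m)}. A *\<^sub>v v = a \<cdot>\<^sub>v v})
    = (CARD('a) ^ Suc m - 1) * CARD('a) ^ m * card {D \<in> carrier_mat m m. S ([:-a, 1:] * char_poly D)}"
proof -
  let ?n = "Suc m"
  let ?V = "carrier_vec ?n - {0\<^sub>v ?n} :: 'a vec set"
  let ?M = "{A \<in> carrier_mat ?n ?n. S (char_poly A)}"
  have fin: "finite ?M" "finite ?V"
    by (auto simp: finite_carrier_vec_and_card intro: finite_subset[OF _ finite_carrier_mat])
  have "(\<Sum>A\<in>?M. card {v \<in> ?V. A *\<^sub>v v = a \<cdot>\<^sub>v v}) = (\<Sum>v\<in>?V. card {A \<in> ?M. A *\<^sub>v v = a \<cdot>\<^sub>v v})"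
    by (rule sum_multicount_gen[OF fin(1,2)]) auto
  also have "\<dots> = (\<Sum>v\<in>?V. CARD('a) ^ m * card {D \<in> carrier_mat m m. S ([:-a, 1:] * char_poly D)})"
  proof (intro sum.cong refl)
    fix v assume "v \<in> ?V"
    moreover have "{A \<in> ?M. A *\<^sub>v v = a \<cdot>\<^sub>v v} =
        {A \<in> carrier_mat ?n ?n. A *\<^sub>v v = a \<cdot>\<^sub>v v \<and> S (char_poly A)}" by auto
    ultimately show "card {A \<in> ?M. A *\<^sub>v v = a \<cdot>\<^sub>v v} =
        CARD('a) ^ m * card {D \<in> carrier_mat m m. S ([:-a, 1:] * char_poly D)}"
      using card_fixed_eigenvector[of v m a S] by simp
  qed
  finally show ?thesis by (simp add: card_nonzero_vecs del: power_Suc)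
qed

section \<open>The probability of a single eigenvalue\<close>

definition mat_prob :: "nat \<Rightarrow> 'a::{field,finite} mat set \<Rightarrow> real" where
  "mat_prob n X = measure_pmf.prob (pmf_of_set (carrier_mat n n)) X"

text \<open>The probability that every element of \<open>T\<close> is an eigenvalue, expressed through the characteristic
  polynomial, in which form the counts by eigenvector apply.\<close>

definition root_prob :: "nat \<Rightarrow> 'a::{field,finite} set \<Rightarrow> real" where
  "root_prob n T = mat_prob n {A. \<forall>t\<in>T. poly (char_poly A) t = 0}"

lemma mat_prob_eq:
  "mat_prob n {A :: 'a::{field,finite} mat. S A} =
    real (card {A \<in> carrier_mat n n. S A}) / real CARD('a) ^ (n * n)"
proof -
  have "{A :: 'a mat. S A} \<inter> carrier_mat n n = {A \<in> carrier_mat n n. S A}" by auto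
  then show ?thesis unfolding mat_prob_def
    by (simp add: measure_pmf_of_set[OF carrier_mat_nonempty finite_carrier_mat] card_carrier_mat Int_commute)
qed

lemma mat_prob_mono:
  assumes "\<And>A. A \<in> carrier_mat n n \<Longrightarrow> S A \<Longrightarrow> S' A"
  shows "mat_prob n {A :: 'a::{field,finite} mat. S A} \<le> mat_prob n {A. S' A}"
  unfolding mat_prob_eq
  by (intro divide_right_mono of_nat_mono card_mono finite_subset[OF _ finite_carrier_mat]) (use assms in auto)

lemma mat_prob_cong:
  assumes "\<And>A. A \<in> carrier_mat n n \<Longrightarrow> S A \<longleftrightarrow> S' A"
  shows "mat_prob n {A :: 'a::{field,finite} mat. S A} = mat_prob n {A. S' A}"
  by (intro antisym mat_prob_mono) (use assms in auto)

lemma mat_prob_not: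
  "mat_prob n {A :: 'a::{field,finite} mat. \<not> S A} = 1 - mat_prob n {A. S A}"
  unfolding mat_prob_def using measure_pmf.prob_compl[of "{A. S A}" "pmf_of_set (carrier_mat n n)"]
  by (simp add: Compl_eq_Diff_UNIV[symmetric] Collect_neg_eq)

lemma card_field_ge_2: "real CARD('a::{field,finite}) \<ge> 2"
proof -
  have "card {0, 1::'a} \<le> CARD('a)" by (intro card_mono) auto
  then show ?thesis by simp
qed

text \<open>The factor with which the counts in dimension \<open>m + 1\<close> exceed those in dimension \<open>m\<close>, after
  division by the total numbers of matrices.\<close>

lemma block_count_normalization:
  fixes q :: real
  assumes "q \<ge> 2"
  shows "(q ^ Suc m - 1) * q ^ m / q ^ (Suc m * Suc m) = (1 - 1 / q ^ Suc m) / q ^ (m * m)"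
proof -
  have "q ^ (Suc m * Suc m) = q ^ (m * m) * q ^ m * q ^ Suc m" by (simp add: power_add[symmetric] algebra_simps)
  then show ?thesis using assms by (simp add: field_simps del: power_Suc)
qed

lemma real_card_minus_1: "real (CARD('a::finite) ^ k - 1) = real CARD('a) ^ k - 1"
proof -
  have "CARD('a) ^ k \<ge> 1" by (simp add: Suc_leI)
  then show ?thesis by (simp add: of_nat_diff)
qed

lemma nonsingular_prob_Suc:
  "mat_prob (Suc m) {A :: 'a::{field,finite} mat. det A \<noteq> 0} =
    (1 - 1 / real CARD('a) ^ Suc m) * mat_prob m {A :: 'a mat. det A \<noteq> 0}"
proof -
  have "mat_prob (Suc m) {A :: 'a mat. det A \<noteq> 0} =
      (real CARD('a) ^ Suc m - 1) * real CARD('a) ^ m / real CARD('a) ^ (Suc m * Suc m) *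
      real (card {D \<in> carrier_mat m m. det D \<noteq> (0::'a)})"
    unfolding mat_prob_eq card_nonsingular_Suc by (simp add: real_card_minus_1 del: power_Suc)
  then show ?thesis unfolding block_count_normalization[OF card_field_ge_2] mat_prob_eq by simp
qed

text \<open>Translation by a scalar matrix moves the eigenvalue \<open>b\<close> to \<open>0\<close>.\<close>

lemma card_root_eq_card_det_0:
  fixes b :: "'a::{field,finite}"
  shows "card {A \<in> carrier_mat n n. poly (char_poly A) b = 0} = card {A \<in> carrier_mat n n. det A = (0::'a)}"
proof (rule bij_betw_same_card)
  have iff: "poly (char_poly A) b = 0 \<longleftrightarrow> det (char_matrix A b) = 0" if "A \<in> carrier_mat n n" for A
    using eigenvalue_det[OF that] eigenvalue_root_char_poly[OF that] by metis
  have inv: "char_matrix (A + b \<cdot>\<^sub>m 1\<^sub>m n) b = A" if "A \<in> carrier_mat n n" for A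
    using that by (intro eq_matI) (auto simp: char_matrix_def)
  show "bij_betw (\<lambda>A. char_matrix A b) {A \<in> carrier_mat n n. poly (char_poly A) b = 0}
      {A \<in> carrier_mat n n. det A = (0::'a)}"
  proof (rule bij_betw_byWitness[where f' = "\<lambda>A. A + b \<cdot>\<^sub>m 1\<^sub>m n"])
    show "\<forall>A\<in>{A \<in> carrier_mat n n. poly (char_poly A) b = 0}. char_matrix A b + b \<cdot>\<^sub>m 1\<^sub>m n = A"
      by (auto simp: char_matrix_def intro!: eq_matI)
    show "(\<lambda>A. char_matrix A b) ` {A \<in> carrier_mat n n. poly (char_poly A) b = 0} \<subseteq>
        {A \<in> carrier_mat n n. det A = (0::'a)}" by (auto simp: iff)
    show "(\<lambda>A. A + b \<cdot>\<^sub>m 1\<^sub>m n) ` {A \<in> carrier_mat n n. det A = (0::'a)} \<subseteq>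
        {A \<in> carrier_mat n n. poly (char_poly A) b = 0}"
      by (auto simp: iff inv)
  qed (auto simp: inv)
qed

lemma root_prob_singleton:
  fixes b :: "'a::{field,finite}"
  shows "root_prob n {b} = 1 - mat_prob n {A :: 'a mat. det A \<noteq> 0}"
  unfolding root_prob_def mat_prob_not mat_prob_eq by (simp add: card_root_eq_card_det_0)

lemma root_prob_singleton_Suc:
  fixes b :: "'a::{field,finite}"
  shows "1 - root_prob (Suc m) {b} = (1 - 1 / real CARD('a) ^ Suc m) * (1 - root_prob m {b})"
  unfolding root_prob_singleton by (simp add: nonsingular_prob_Suc del: power_Suc)

lemma root_prob_eq_0_if_card_gt:
  fixes T :: "'a::{field,finite} set"
  assumes "card T > n"
  shows "root_prob n T = 0"
proof -
  have "\<not> (\<forall>t\<in>T. poly (char_poly A) t = 0)" if A: "A \<in> carrier_mat n n" for A :: "'a mat"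
  proof
    assume "\<forall>t\<in>T. poly (char_poly A) t = 0"
    then have "T \<subseteq> {t. poly (char_poly A) t = 0}" by auto
    then have "card T \<le> card {t. poly (char_poly A) t = 0}" by (intro card_mono) auto
    moreover have "char_poly A \<noteq> 0" using degree_monic_char_poly[OF A] by auto
    then have "card {t. poly (char_poly A) t = 0} \<le> n"
      using poly_roots_degree[of "char_poly A"] degree_monic_char_poly[OF A] by simp
    ultimately show False using assms by simp
  qed
  then show ?thesis unfolding root_prob_def by (subst mat_prob_cong[of _ _ "\<lambda>_. False"]) (auto simp: mat_prob_def)
qed


lemma root_prob_dim_0: "root_prob 0 {b} = 0"
  by (rule root_prob_eq_0_if_card_gt) simp

lemma root_prob_singleton_mono:
  fixes b :: "'a::{field,finite}"
  assumes "m \<le> n"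
  shows "root_prob m {b} \<le> root_prob n {b}"
  using assms
proof (rule lift_Suc_mono_le[rotated])
  fix n
  have "root_prob n {b} \<le> 1" by (simp add: root_prob_def mat_prob_def)
  then have "(1 - 1 / real CARD('a) ^ Suc n) * (1 - root_prob n {b}) \<le> 1 * (1 - root_prob n {b})"
    by (intro mult_right_mono) auto
  then show "root_prob n {b} \<le> root_prob (Suc n) {b}"
    using root_prob_singleton_Suc[of n b] by simp
qed

lemma root_prob_dim_1_2_3:
  fixes b :: "'a::{field,finite}"
  defines "q \<equiv> real CARD('a)"
  shows "root_prob (Suc 0) {b} = 1 / q"
    and "root_prob 2 {b} = 1 - (1 - 1 / q) * (1 - 1 / q^2)"
    and "root_prob 3 {b} = 1 - (1 - 1 / q) * (1 - 1 / q^2) * (1 - 1 / q^3)"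
proof -
  note step = root_prob_singleton_Suc[of _ b, folded q_def]
  have 1: "1 - root_prob (Suc 0) {b} = 1 - 1 / q" using step[of 0] by (simp add: root_prob_dim_0)
  have 2: "1 - root_prob 2 {b} = (1 - 1 / q) * (1 - 1 / q^2)" using step[of "Suc 0"] 1
    by (simp add: numeral_2_eq_2)
  have 3: "1 - root_prob 3 {b} = (1 - 1 / q) * (1 - 1 / q^2) * (1 - 1 / q^3)" using step[of 2] 2
    by (simp add: numeral_3_eq_3)
  show "root_prob (Suc 0) {b} = 1 / q"
    "root_prob 2 {b} = 1 - (1 - 1 / q) * (1 - 1 / q^2)"
    "root_prob 3 {b} = 1 - (1 - 1 / q) * (1 - 1 / q^2) * (1 - 1 / q^3)"
    using 1 2 3 by (simp_all only: One_nat_def)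
qed

section \<open>The probability of several eigenvalues\<close>

lemma mat_prob_char_poly_eigenvectors:
  fixes a :: "'a::{field,finite}"
  shows "(\<Sum>A\<in>{A \<in> carrier_mat (Suc m) (Suc m). S (char_poly A)}.
        real (card {v \<in> carrier_vec (Suc m) - {0\<^sub>v (Suc m)}. A *\<^sub>v v = a \<cdot>\<^sub>v v}))
      / real CARD('a) ^ (Suc m * Suc m)
    = (1 - 1 / real CARD('a) ^ Suc m) * mat_prob m {D. S ([:-a, 1:] * char_poly D)}"
proof -
  have "(\<Sum>A\<in>{A \<in> carrier_mat (Suc m) (Suc m). S (char_poly A)}.
        real (card {v \<in> carrier_vec (Suc m) - {0\<^sub>v (Suc m)}. A *\<^sub>v v = a \<cdot>\<^sub>v v}))
      / real CARD('a) ^ (Suc m * Suc m) =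
      (real CARD('a) ^ Suc m - 1) * real CARD('a) ^ m / real CARD('a) ^ (Suc m * Suc m) *
      real (card {D \<in> carrier_mat m m. S ([:-a, 1:] * char_poly D)})"
    unfolding of_nat_sum[symmetric] sum_card_eigenvectors by (simp add: real_card_minus_1 del: power_Suc)
  then show ?thesis unfolding block_count_normalization[OF card_field_ge_2] mat_prob_eq by simp
qed

text \<open>Each matrix with eigenvalue \<open>a\<close> is counted at least \<open>q - 1\<close> times among the pairs of a matrix
  and an eigenvector, because the nonzero multiples of an eigenvector are eigenvectors.\<close>

lemma mat_prob_root_le:
  fixes a :: "'a::{field,finite}"
  shows "mat_prob (Suc m) {A. poly (char_poly A) a = 0 \<and> S (char_poly A)}
    \<le> (1 - 1 / real CARD('a) ^ Suc m) / (real CARD('a) - 1) * mat_prob m {D. S ([:-a, 1:] * char_poly D)}"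
proof -
  let ?n = "Suc m" and ?q = "real CARD('a)"
  let ?S = "\<lambda>f. poly f a = 0 \<and> S f"
  let ?M = "{A \<in> carrier_mat ?n ?n. ?S (char_poly A)}"
  let ?E = "\<lambda>A. {v \<in> carrier_vec ?n - {0\<^sub>v ?n}. A *\<^sub>v v = a \<cdot>\<^sub>v v}"
  have "?q - 1 \<le> real (card (?E A))" if "A \<in> ?M" for A
  proof -
    from that have A: "A \<in> carrier_mat ?n ?n" and "eigenvalue A a"
      using eigenvalue_root_char_poly by auto
    then obtain v where v: "v \<in> carrier_vec ?n" "v \<noteq> 0\<^sub>v ?n" "A *\<^sub>v v = a \<cdot>\<^sub>v v"
      by (auto simp: eigenvalue_def eigenvector_def)
    obtain i where i: "i < ?n" "v $ i \<noteq> 0" using v by (metis carrier_vecD eq_vecI index_zero_vec)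
    have inj: "inj_on (\<lambda>c. c \<cdot>\<^sub>v v) (UNIV - {0})"
    proof (rule inj_onI)
      fix c d assume "c \<cdot>\<^sub>v v = d \<cdot>\<^sub>v v"
      then have "(c \<cdot>\<^sub>v v) $ i = (d \<cdot>\<^sub>v v) $ i" by simp
      then show "c = d" using i v(1) by simp
    qed
    have "(\<lambda>c. c \<cdot>\<^sub>v v) ` (UNIV - {0}) \<subseteq> ?E A"
    proof safe
      fix c :: 'a assume "c \<noteq> 0" "c \<cdot>\<^sub>v v = 0\<^sub>v ?n"
      then have "(c \<cdot>\<^sub>v v) $ i = 0" using i by simp
      then show False using i v(1) \<open>c \<noteq> 0\<close> by simp
    next
      fix c :: 'a
      show "A *\<^sub>v (c \<cdot>\<^sub>v v) = a \<cdot>\<^sub>v (c \<cdot>\<^sub>v v)"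
        using mult_mat_vec[OF A v(1)] v(3) by (simp add: smult_smult_assoc mult.commute)
    qed (use v in auto)
    then have "card ((\<lambda>c. c \<cdot>\<^sub>v v) ` (UNIV - {0})) \<le> card (?E A)"
      by (intro card_mono) (auto simp: finite_carrier_vec_and_card)
    then have "CARD('a) - 1 \<le> card (?E A)" by (simp add: card_image[OF inj] card_Diff_singleton)
    then show ?thesis by linarith
  qed
  then have "real (card ?M) * (?q - 1) \<le> (\<Sum>A\<in>?M. real (card (?E A)))"
    using sum_mono[of ?M "\<lambda>_. ?q - 1"] by simp
  then have "mat_prob ?n {A. ?S (char_poly A)} * (?q - 1) \<le>
      (\<Sum>A\<in>?M. real (card (?E A))) / ?q ^ (?n * ?n)"
    unfolding mat_prob_eq using divide_right_mono[of _ _ "?q ^ (?n * ?n)"] by simp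
  also have "\<dots> = (1 - 1 / ?q ^ ?n) * mat_prob m {D. ?S ([:-a, 1:] * char_poly D)}"
    by (rule mat_prob_char_poly_eigenvectors)
  also have "{D. ?S ([:-a, 1:] * char_poly D)} = {D. S ([:-a, 1:] * char_poly D)}" by simp
  finally show ?thesis using card_field_ge_2[where 'a='a] by (simp add: field_simps)
qed

text \<open>After moving one eigenvector to the first unit vector, \<open>g\<close> becomes the characteristic polynomial of
  the lower right block, so all other eigenvectors for \<open>a\<close> are multiples of the first.\<close>

lemma card_eigenvectors_simple_root:
  fixes a :: "'a::{field,finite}"
  assumes A: "A \<in> carrier_mat (Suc m) (Suc m)"
    and f: "char_poly A = [:-a, 1:] * g" and g: "poly g a \<noteq> 0"
  shows "card {v \<in> carrier_vec (Suc m) - {0\<^sub>v (Suc m)}. A *\<^sub>v v = a \<cdot>\<^sub>v v} \<le> CARD('a) - 1"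
    (is "card ?E \<le> _")
proof (cases "?E = {}")
  case False
  let ?n = "Suc m" and ?e = "unit_vec (Suc m) 0 :: 'a vec"
  from False obtain v where v: "v \<in> carrier_vec ?n" "v \<noteq> 0\<^sub>v ?n" "A *\<^sub>v v = a \<cdot>\<^sub>v v" by auto
  obtain P Q where P: "P \<in> carrier_mat ?n ?n" and Q: "Q \<in> carrier_mat ?n ?n"
    and PQ: "P * Q = 1\<^sub>m ?n" and QP: "Q * P = 1\<^sub>m ?n" and Pe: "P *\<^sub>v ?e = v"
    using exists_invertible_first_column[OF v(1,2)] by metis
  have e: "?e \<in> carrier_vec ?n" by simp
  have Qw: "P *\<^sub>v (Q *\<^sub>v w) = w" "Q *\<^sub>v (P *\<^sub>v w) = w" if "w \<in> carrier_vec ?n" for w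
    using that P Q PQ QP by (simp_all add: assoc_mult_mat_vec[of _ ?n ?n _ ?n, symmetric])
  define B where "B = Q * A * P"
  have B: "B \<in> carrier_mat ?n ?n" using P Q A by (simp add: B_def)
  have Bw: "B *\<^sub>v (Q *\<^sub>v w) = a \<cdot>\<^sub>v (Q *\<^sub>v w)" if w: "w \<in> carrier_vec ?n" "A *\<^sub>v w = a \<cdot>\<^sub>v w" for w
  proof -
    have "B *\<^sub>v (Q *\<^sub>v w) = Q *\<^sub>v (A *\<^sub>v (P *\<^sub>v (Q *\<^sub>v w)))"
      unfolding B_def using P Q A w(1) by (simp add: assoc_mult_mat_vec[of _ ?n ?n _ ?n])
    then show ?thesis using w Qw(1)[OF w(1)] mult_mat_vec[OF Q w(1)] by simp
  qed
  have "Q *\<^sub>v v = ?e" using Qw(2)[OF e] Pe by simp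
  then have "B \<in> {A \<in> carrier_mat ?n ?n. A *\<^sub>v ?e = a \<cdot>\<^sub>v ?e}" using Bw[OF v(1,3)] B by simp
  then obtain R D where R: "R \<in> carrier_mat 1 m" and D: "D \<in> carrier_mat m m"
    and BRD: "B = block_upper m a R D" unfolding first_vector_eigen_eq_block_upper by auto
  have "similar_mat B A" unfolding similar_mat_def B_def
    by (rule exI[of _ Q], rule exI[of _ P], rule similar_mat_witI[OF QP PQ refl]) (use P Q A in auto)
  then have "[:-a, 1:] * char_poly D = [:-a, 1:] * g"
    using char_poly_similar f char_poly_block_upper[OF R D] BRD by metis
  then have "char_poly D = g" by (subst (asm) mult_cancel_left) auto
  then have na: "poly (char_poly D) a \<noteq> 0" using g by simp
  have "?E \<subseteq> (\<lambda>c. c \<cdot>\<^sub>v v) ` (UNIV - {0})"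
  proof
    fix w assume "w \<in> ?E"
    then have w: "w \<in> carrier_vec ?n" "w \<noteq> 0\<^sub>v ?n" "A *\<^sub>v w = a \<cdot>\<^sub>v w" by auto
    define c where "c = (Q *\<^sub>v w) $ 0"
    have "Q *\<^sub>v w = c \<cdot>\<^sub>v ?e" unfolding c_def
      by (rule eigenvector_block_upper[OF R D na]) (use Bw[OF w(1,3)] BRD Q w(1) in auto)
    then have "w = c \<cdot>\<^sub>v v" using Qw(1)[OF w(1)] mult_mat_vec[OF P e] Pe by simp
    moreover have "c \<noteq> 0" using calculation w(2) v(1) by auto
    ultimately show "w \<in> (\<lambda>c. c \<cdot>\<^sub>v v) ` (UNIV - {0})" by auto
  qed
  then have "card ?E \<le> card (UNIV - {0::'a})" by (rule surj_card_le[rotated]) auto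
  then show ?thesis by (simp add: card_Diff_singleton)
qed (simp only: card.empty)

text \<open>Only the matrices in which \<open>a\<close> is a simple root are counted on the left: each of them contributes
  at most \<open>q - 1\<close> pairs of a matrix and an eigenvector. Larger eigenspaces, which would contribute
  more, occur only at multiple roots.\<close>

lemma mat_prob_root_ge:
  fixes a :: "'a::{field,finite}"
  shows "(1 - 1 / real CARD('a) ^ Suc m) / (real CARD('a) - 1) *
      mat_prob m {D. poly (char_poly D) a \<noteq> 0 \<and> S ([:-a, 1:] * char_poly D)}
    \<le> mat_prob (Suc m) {A. poly (char_poly A) a = 0 \<and> S (char_poly A)}"
proof -
  let ?n = "Suc m" and ?q = "real CARD('a)"
  let ?S = "\<lambda>f. S f \<and> (\<exists>g. f = [:-a, 1:] * g \<and> poly g a \<noteq> 0)"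
  let ?M = "{A \<in> carrier_mat ?n ?n. ?S (char_poly A)}"
  let ?E = "\<lambda>A. {v \<in> carrier_vec ?n - {0\<^sub>v ?n}. A *\<^sub>v v = a \<cdot>\<^sub>v v}"
  have S': "?S ([:-a, 1:] * f) \<longleftrightarrow> poly f a \<noteq> 0 \<and> S ([:-a, 1:] * f)" for f
    by (subst mult_cancel_left) auto
  have "real (card (?E A)) \<le> ?q - 1" if "A \<in> ?M" for A
  proof -
    have "card (?E A) \<le> CARD('a) - 1" using that card_eigenvectors_simple_root[of A m a] by blast
    then show ?thesis using card_field_ge_2[where 'a='a] by linarith
  qed
  then have "(\<Sum>A\<in>?M. real (card (?E A))) \<le> real (card ?M) * (?q - 1)"
    using sum_mono[of ?M _ "\<lambda>_. ?q - 1"] by simp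
  then have "(\<Sum>A\<in>?M. real (card (?E A))) / ?q ^ (?n * ?n) \<le> mat_prob ?n {A. ?S (char_poly A)} * (?q - 1)"
    unfolding mat_prob_eq using divide_right_mono[of _ _ "?q ^ (?n * ?n)"] by simp
  also have "(\<Sum>A\<in>?M. real (card (?E A))) / ?q ^ (?n * ?n) =
      (1 - 1 / ?q ^ ?n) * mat_prob m {D. ?S ([:-a, 1:] * char_poly D)}"
    by (rule mat_prob_char_poly_eigenvectors)
  \<comment> \<open>The simplicity of the root is only discarded here, after the exact count.\<close>
  also have "mat_prob ?n {A. ?S (char_poly A)} * (?q - 1) \<le>
      mat_prob ?n {A. poly (char_poly A) a = 0 \<and> S (char_poly A)} * (?q - 1)"
    using card_field_ge_2[where 'a='a] by (intro mult_right_mono mat_prob_mono) auto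
  finally show ?thesis unfolding S' using card_field_ge_2[where 'a='a] by (simp add: field_simps)
qed

lemma root_prob_insert_le:
  fixes a :: "'a::{field,finite}"
  assumes "a \<notin> T"
  shows "root_prob (Suc m) (insert a T) \<le>
    (1 - 1 / real CARD('a) ^ Suc m) / (real CARD('a) - 1) * root_prob m T"
proof -
  have "(\<forall>t\<in>T. poly ([:-a, 1:] * f) t = 0) \<longleftrightarrow> (\<forall>t\<in>T. poly f t = 0)" for f
    using assms by auto
  then show ?thesis using mat_prob_root_le[of m a "\<lambda>f. \<forall>t\<in>T. poly f t = 0"]
    by (simp add: root_prob_def del: mult_pCons_left power_Suc)
qed

lemma root_prob_pair_ge:
  fixes a :: "'a::{field,finite}"
  assumes "a \<noteq> b"
  shows "(1 - 1 / real CARD('a) ^ Suc m) / (real CARD('a) - 1) * (root_prob m {b} - root_prob m {a, b})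
    \<le> root_prob (Suc m) {a, b}"
proof -
  have "poly ([:-a, 1:] * f) b = 0 \<longleftrightarrow> poly f b = 0" for f
    using assms by auto
  then have "(1 - 1 / real CARD('a) ^ Suc m) / (real CARD('a) - 1) *
      mat_prob m {D. poly (char_poly D) a \<noteq> 0 \<and> poly (char_poly D) b = 0} \<le> root_prob (Suc m) {a, b}"
    using mat_prob_root_ge[of m a "\<lambda>f. poly f b = 0"]
    by (simp add: root_prob_def del: mult_pCons_left power_Suc)
  moreover have "mat_prob m {D. poly (char_poly D) a \<noteq> 0 \<and> poly (char_poly D) b = 0} =
      mat_prob m ({D. poly (char_poly D) b = 0} - {D. poly (char_poly D) a = 0 \<and> poly (char_poly D) b = 0})"
    by (rule arg_cong[where f = "mat_prob m"]) auto
  moreover have "\<dots> = root_prob m {b} - root_prob m {a, b}"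
    unfolding mat_prob_def root_prob_def by (subst measure_pmf.finite_measure_Diff) (auto)
  ultimately show ?thesis by simp
qed

text \<open>Iterating the previous estimates over the elements of \<open>T\<close>, with one dimension less at each
  element.\<close>

lemma root_prob_le:
  fixes T :: "'a::{field,finite} set"
  shows "root_prob n T \<le> 1 / (real CARD('a) - 1) ^ card T"
proof (induction n arbitrary: T)
  case 0
  show ?case using root_prob_eq_0_if_card_gt[of 0 T] card_field_ge_2[where 'a='a]
    by (cases "card T = 0") (auto simp: root_prob_def mat_prob_def)
next
  case (Suc m)
  have q: "real CARD('a) \<ge> 2" by (rule card_field_ge_2)
  show ?case
  proof (cases "T = {}")
    case True
    then show ?thesis by (simp add: root_prob_def mat_prob_def)
  next
    case False
    then obtain a U where T: "T = insert a U" "a \<notin> U" by (meson Set.set_insert ex_in_conv)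
    have p0: "root_prob m U \<ge> 0" by (simp add: root_prob_def mat_prob_def)
    have "root_prob (Suc m) T \<le> (1 - 1 / real CARD('a) ^ Suc m) / (real CARD('a) - 1) * root_prob m U"
      unfolding T(1) by (rule root_prob_insert_le[OF T(2)])
    also have "\<dots> \<le> 1 / (real CARD('a) - 1) * root_prob m U"
      using q p0 by (intro mult_right_mono divide_right_mono) auto
    also have "\<dots> \<le> 1 / (real CARD('a) - 1) * (1 / (real CARD('a) - 1) ^ card U)"
      using q by (intro mult_left_mono Suc.IH) auto
    also have "\<dots> = 1 / (real CARD('a) - 1) ^ card T" using T by simp
    finally show ?thesis .
  qed
qed

section \<open>Inclusion-exclusion over the twisted pairs\<close>

text \<open>The Bonferroni inequality with uniform bounds for the single events and for their pairwise
  intersections.\<close>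

lemma prob_union_ge:
  assumes "finite I"
    and "\<And>i. i \<in> I \<Longrightarrow> L \<le> measure_pmf.prob p (E i)"
    and "\<And>i j. i \<in> I \<Longrightarrow> j \<in> I \<Longrightarrow> i \<noteq> j \<Longrightarrow> measure_pmf.prob p (E i \<inter> E j) \<le> U"
  shows "real (card I) * L - real (card I) * (real (card I) - 1) / 2 * U \<le> measure_pmf.prob p (\<Union>i\<in>I. E i)"
  using assms
proof (induction I rule: finite_induct)
  case empty
  then show ?case by simp
next
  case (insert i I)
  let ?P = "measure_pmf.prob p" and ?k = "real (card I)"
  have "?P (E i \<inter> (\<Union>j\<in>I. E j)) = ?P (\<Union>j\<in>I. E i \<inter> E j)"
    by (rule arg_cong[where f = ?P]) auto
  also have "\<dots> \<le> (\<Sum>j\<in>I. ?P (E i \<inter> E j))"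
    using insert.hyps by (intro measure_pmf.finite_measure_subadditive_finite) auto
  also have "\<dots> \<le> (\<Sum>j\<in>I. U)" using insert.hyps by (intro sum_mono insert.prems) auto
  finally have cap: "?P (E i \<inter> (\<Union>j\<in>I. E j)) \<le> ?k * U" by simp
  have "?P (E i \<union> (\<Union>j\<in>I. E j)) = ?P (E i) + ?P (\<Union>j\<in>I. E j) - ?P (E i \<inter> (\<Union>j\<in>I. E j))"
    using measure_pmf.finite_measure_Union'[of "E i" p "\<Union>j\<in>I. E j"]
      measure_pmf.finite_measure_Diff'[of "\<Union>j\<in>I. E j" p "E i"] by (simp add: Int_commute)
  moreover have "?k * L - ?k * (?k - 1) / 2 * U \<le> ?P (\<Union>j\<in>I. E j)"
    by (rule insert.IH) (use insert.prems in auto)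
  moreover have "L \<le> ?P (E i)" using insert.prems by simp
  ultimately have "?k * L - ?k * (?k - 1) / 2 * U + L - ?k * U \<le> ?P (\<Union>j\<in>insert i I. E j)"
    using cap by simp
  moreover have "real (card (insert i I)) = ?k + 1" using insert.hyps by simp
  ultimately show ?case by (simp add: field_simps)
qed

text \<open>The pair \<open>{a, lam * a}\<close> determines \<open>a\<close> unless \<open>lam = -1\<close>, but the bound by half the number of
  nonzero scalars holds for every \<open>lam\<close>, because the pairs are two-element sets covering these scalars.
  Working with sets of pairs avoids a choice of representatives.\<close>

lemma twisted_pairs:
  fixes lam :: "'a::{field,finite}"
  assumes lam: "lam \<noteq> 0" "lam \<noteq> 1"
  defines "Ps \<equiv> (\<lambda>a. {a, lam * a}) ` (UNIV - {0})"
  shows "CARD('a) div 2 \<le> card Ps"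
    and "p \<in> Ps \<Longrightarrow> card p = 2" and "p \<in> Ps \<Longrightarrow> 0 \<notin> p"
    and "p \<in> Ps \<Longrightarrow> \<exists>b\<in>p. lam * b \<in> p"
proof -
  have two: "card p = 2" if "p \<in> Ps" for p
  proof -
    obtain a where "p = {a, lam * a}" "a \<noteq> 0" using \<open>p \<in> Ps\<close> by (auto simp: Ps_def)
    then show ?thesis using lam by simp
  qed
  have "UNIV - {0} \<subseteq> \<Union>Ps" by (auto simp: Ps_def)
  then have "card (UNIV - {0 :: 'a}) \<le> card (\<Union>Ps)" by (intro card_mono) auto
  also have "\<dots> \<le> (\<Sum>p\<in>Ps. card p)" by (rule card_Union_le_sum_card)
  also have "\<dots> = 2 * card Ps" using two by simp
  finally have "CARD('a) - 1 \<le> 2 * card Ps" by (simp add: card_Diff_singleton)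
  then show "CARD('a) div 2 \<le> card Ps" by linarith
  show "p \<in> Ps \<Longrightarrow> card p = 2" by (rule two)
  show "p \<in> Ps \<Longrightarrow> 0 \<notin> p" using lam by (auto simp: Ps_def)
  show "p \<in> Ps \<Longrightarrow> \<exists>b\<in>p. lam * b \<in> p" by (auto simp: Ps_def)
qed

lemma prob_nonzero_ge_mat_prob:
  fixes lam :: "'a::{field,finite}"
  assumes "\<And>A. A \<in> carrier_mat n n \<Longrightarrow> S A \<Longrightarrow> \<exists>b. poly (char_poly A) b = 0 \<and> poly (char_poly A) (lam * b) = 0"
  shows "mat_prob n {A. S A} \<le> prob_nonzero_twisted_centralizer n lam"
  unfolding prob_nonzero_twisted_centralizer_def mat_prob_def[symmetric]
proof (rule mat_prob_mono)
  fix A :: "'a mat" assume A: "A \<in> carrier_mat n n" "S A"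
  then obtain b where "poly (char_poly A) b = 0" "poly (char_poly A) (lam * b) = 0"
    using assms by blast
  then show "twisted_centralizer n A lam \<noteq> {0\<^sub>m n n}"
    using twisted_centralizer_nonzero_of_roots A by blast
qed

lemma prob_nonzero_ge_root_prob_0:
  fixes lam :: "'a::{field,finite}"
  shows "root_prob n {0 :: 'a} \<le> prob_nonzero_twisted_centralizer n lam"
  unfolding root_prob_def by (rule prob_nonzero_ge_mat_prob) (auto intro: exI[of _ 0])

text \<open>Besides \<open>0 \<in> K\<close>, the events are that \<open>K\<close> contains a given twisted pair but not \<open>0\<close>. Each has
  probability at least \<open>P2 - P3\<close>, and two of them together require three eigenvalues.\<close>

lemma prob_nonzero_ge_inclusion_exclusion:
  fixes lam :: "'a::{field,finite}"
  assumes lam: "lam \<noteq> 0" "lam \<noteq> 1"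
    and P2: "\<And>a b :: 'a. a \<noteq> b \<Longrightarrow> P2 \<le> root_prob n {a, b}"
    and P3: "\<And>T :: 'a set. card T = 3 \<Longrightarrow> root_prob n T \<le> P3"
  defines "m \<equiv> real (CARD('a) div 2)"
  shows "root_prob n {0 :: 'a} + (m * (P2 - P3) - m * (m - 1) / 2 * P3)
    \<le> prob_nonzero_twisted_centralizer n lam"
proof -
  define R where "R T = {A. \<forall>t\<in>T. poly (char_poly A) t = 0}" for T :: "'a set"
  define Ps where "Ps = (\<lambda>a. {a, lam * a}) ` (UNIV - {0})"
  note Ps = twisted_pairs[OF lam, folded Ps_def]
  obtain I where I: "I \<subseteq> Ps" "card I = CARD('a) div 2" "finite I"
    using obtain_subset_with_card_n[OF Ps(1)] by metis
  let ?p = "pmf_of_set (carrier_mat n n :: 'a mat set)"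
  let ?P = "measure_pmf.prob ?p"
  have RP: "?P (R T) = root_prob n T" for T by (simp add: R_def root_prob_def mat_prob_def)
  define E where "E p = R p - R {0}" for p
  have Int_R: "R T \<inter> R T' = R (T \<union> T')" for T T' by (auto simp: R_def)
  have "P2 - P3 \<le> ?P (E p)" if p: "p \<in> I" for p
  proof -
    have "card p = 2" "0 \<notin> p" using p I Ps by auto
    then obtain a b where ab: "p = {a, b}" "a \<noteq> b" by (auto simp: card_2_iff)
    have "?P (E p) = ?P (R p) - ?P (R p \<inter> R {0})"
      unfolding E_def by (rule measure_pmf.finite_measure_Diff') auto
    also have "\<dots> = root_prob n p - root_prob n (p \<union> {0})" by (simp add: Int_R RP)
    finally show ?thesis using P2[OF ab(2)] P3[of "p \<union> {0}"] ab \<open>0 \<notin> p\<close> by simp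
  qed
  moreover have "?P (E p \<inter> E p') \<le> P3" if pp: "p \<in> I" "p' \<in> I" "p \<noteq> p'" for p p'
  proof -
    have c: "card p = 2" "card p' = 2" using pp I Ps by auto
    have "\<not> p' \<subseteq> p" using c pp(3) by (metis card.infinite card_subset_eq zero_neq_numeral)
    then obtain x where x: "x \<in> p'" "x \<notin> p" by auto
    then have "card (insert x p) = 3" using c by simp
    then have "root_prob n (insert x p) \<le> P3" by (rule P3)
    moreover have "?P (E p \<inter> E p') \<le> ?P (R (insert x p))"
      using x by (intro measure_pmf.finite_measure_mono) (auto simp: E_def R_def)
    ultimately show ?thesis by (simp add: RP)
  qed
  ultimately have "m * (P2 - P3) - m * (m - 1) / 2 * P3 \<le> ?P (\<Union>p\<in>I. E p)"
    unfolding m_def I(2)[symmetric] by (rule prob_union_ge[OF I(3)])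
  moreover have "?P (R {0} \<union> (\<Union>p\<in>I. E p)) = ?P (R {0}) + ?P (\<Union>p\<in>I. E p)"
    by (rule measure_pmf.finite_measure_Union) (auto simp: E_def)
  moreover have "?P (R {0} \<union> (\<Union>p\<in>I. E p)) \<le> prob_nonzero_twisted_centralizer n lam"
  proof -
    have "\<exists>b. poly (char_poly A) b = 0 \<and> poly (char_poly A) (lam * b) = 0"
      if A: "A \<in> R {0} \<union> (\<Union>p\<in>I. E p)" for A
    proof (cases "A \<in> R {0}")
      case False
      then obtain p where p: "p \<in> I" "A \<in> R p" using A by (auto simp: E_def)
      then obtain b where "b \<in> p" "lam * b \<in> p" using I Ps(4) by blast
      then show ?thesis using p(2) by (auto simp: R_def)
    qed (auto simp: R_def intro: exI[of _ 0])
    then have "mat_prob n {A. A \<in> R {0} \<union> (\<Union>p\<in>I. E p)} \<le> prob_nonzero_twisted_centralizer n lam"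
      by (rule prob_nonzero_ge_mat_prob)
    then show ?thesis by (simp only: mat_prob_def Collect_mem_eq)
  qed
  ultimately show ?thesis by (simp add: RP)
qed

section \<open>Numerical estimates\<close>

text \<open>Here two distinct eigenvalues are the most possible, so that the term \<open>P3\<close> vanishes and the
  value of \<open>P2\<close> is exact.\<close>

lemma prob_nonzero_ge_dim_2:
  fixes lam :: "'a::{field,finite}"
  assumes lam: "lam \<noteq> 0" "lam \<noteq> 1"
  shows "5 / 4 * (1 / real CARD('a)) \<le> prob_nonzero_twisted_centralizer 2 lam"
proof -
  define q where "q = real CARD('a)"
  have q: "q \<ge> 2" unfolding q_def by (rule card_field_ge_2)
  define m where "m = real (CARD('a) div 2)"
  have m: "(q - 1) / 2 \<le> m"
  proof -
    have "CARD('a) \<le> 2 * (CARD('a) div 2) + 1" by linarith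
    then have "real CARD('a) \<le> real (2 * (CARD('a) div 2) + 1)" by (simp only: of_nat_le_iff)
    then show ?thesis by (simp add: q_def m_def)
  qed
  have "(1 - 1 / q^2) / (q - 1) * (1 / q) \<le> root_prob 2 {a, b}" if "a \<noteq> b" for a b :: 'a
    using root_prob_pair_ge[OF that, of 1] root_prob_eq_0_if_card_gt[of 1 "{a, b}"] that
    by (simp add: root_prob_dim_1_2_3(1) q_def numeral_2_eq_2 mult.commute)
  moreover have "root_prob 2 T \<le> 0" if "card T = 3" for T :: "'a set"
    using root_prob_eq_0_if_card_gt[of 2 T] that by simp
  ultimately have "root_prob 2 {0 :: 'a} + m * ((1 - 1 / q^2) / (q - 1) * (1 / q))
      \<le> prob_nonzero_twisted_centralizer 2 lam"
    using prob_nonzero_ge_inclusion_exclusion[OF lam, of "(1 - 1 / q^2) / (q - 1) * (1 / q)" 2 0]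
    by (simp add: m_def)
  moreover have "(q - 1) / 2 * ((1 - 1 / q^2) / (q - 1) * (1 / q)) \<le> m * ((1 - 1 / q^2) / (q - 1) * (1 / q))"
    using q m by (intro mult_right_mono) auto
  moreover have "5 / 4 * (1 / q) \<le>
      (1 - (1 - 1 / q) * (1 - 1 / q^2)) + (q - 1) / 2 * ((1 - 1 / q^2) / (q - 1) * (1 / q))" (is "?l \<le> ?r")
  proof -
    have "?r - ?l = (q^2 + 4 * q - 6) / (4 * q^3)" using q
      by (simp add: field_simps power2_eq_square power3_eq_cube)
    moreover have "q^2 + 4 * q - 6 \<ge> 0" using q zero_le_power2[of q] by linarith
    ultimately have "?r - ?l \<ge> 0" using q by simp
    then show ?thesis by simp
  qed
  ultimately show ?thesis by (simp add: root_prob_dim_1_2_3(2) q_def)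
qed

text \<open>In terms of \<open>t = q - 4\<close> the difference of the two sides is a quotient of polynomials with positive
  coefficients. The two values of \<open>x\<close> are those of the integer part of \<open>q / 2\<close> for odd and even \<open>q\<close>.\<close>

lemma inclusion_exclusion_bound_ge:
  fixes q x :: real
  assumes q: "q \<ge> 4" and x: "x = (q - 1) / 2 \<or> x = q / 2"
  shows "(1 - (1 - 1/q) * (1 - 1/q^2) * (1 - 1/q^3))
    + (x * ((1 - 1/q^3) / (q - 1) * ((1 - (1 - 1/q) * (1 - 1/q^2)) - 1/(q - 1)^2) - 1/(q - 1)^3)
    - x * (x - 1) / 2 * (1/(q - 1)^3)) \<ge> 5/4 * (1/q)" (is "?L x \<ge> ?R")
proof -
  define t where "t = q - 4"
  have t: "t \<ge> 0" "q = t + 4" using q by (auto simp: t_def)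
  have nz: "t + 4 \<noteq> 0" "t + 3 \<noteq> 0" using t by auto
  have e: "t + 4 - 1 = t + 3" by simp
  have "?L ((q - 1) / 2) - ?R =
      (15348 + 54928*t + 68564*t^2 + 43660*t^3 + 16124*t^4 + 3594*t^5 + 475*t^6 + 34*t^7 + t^8)
      / (8 * (t + 4)^6 * (t + 3)^3)"
    unfolding t(2) e using nz
    by (simp add: divide_simps) (simp add: algebra_simps power_numeral_reduce)
  moreover have "\<dots> \<ge> 0" using t(1) by simp
  ultimately have odd: "?L ((q - 1) / 2) \<ge> ?R" by linarith
  have "?L (q / 2) - ?R =
      (5448 + 49028*t + 72716*t^2 + 48912*t^3 + 18292*t^4 + 4042*t^5 + 522*t^6 + 36*t^7 + t^8)
      / (8 * (t + 4)^6 * (t + 3)^3)"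
    unfolding t(2) e using nz
    by (simp add: divide_simps) (simp add: algebra_simps power_numeral_reduce)
  moreover have "\<dots> \<ge> 0" using t(1) by simp
  ultimately have even: "?L (q / 2) \<ge> ?R" by linarith
  from x show ?thesis
  proof
    assume "x = (q - 1) / 2"
    then show ?thesis using odd by (simp only:)
  next
    assume "x = q / 2"
    then show ?thesis using even by (simp only:)
  qed
qed

text \<open>The estimates for \<open>P2\<close> and for the singular matrices improve with \<open>n\<close>, so their values at \<open>n = 3\<close>
  can be used throughout.\<close>

lemma prob_nonzero_ge_dim_ge_3:
  fixes lam :: "'a::{field,finite}"
  assumes lam: "lam \<noteq> 0" "lam \<noteq> 1" and n: "n \<ge> 3"
  shows "5 / 4 * (1 / real CARD('a)) \<le> prob_nonzero_twisted_centralizer n lam"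
proof -
  define q where "q = real CARD('a)"
  have "card {0, 1, lam} \<le> CARD('a)" by (intro card_mono) auto
  then have c3: "CARD('a) \<ge> 3" using lam by simp
  have s: "1 - (1 - 1 / q) * (1 - 1 / q^2) * (1 - 1 / q^3) \<le> root_prob n {0 :: 'a}"
    using root_prob_singleton_mono[OF n, of "0 :: 'a"] by (simp add: root_prob_dim_1_2_3(3) q_def)
  show ?thesis
  proof (cases "CARD('a) = 3")
    case True
    \<comment> \<open>The proportion of singular matrices is at least \<open>313/729\<close>, more than \<open>5/12\<close>.\<close>
    then show ?thesis
      using s prob_nonzero_ge_root_prob_0[of n lam] by (simp add: q_def)
  next
    case False
    then have q: "q \<ge> 4" using c3 by (simp add: q_def)
    define m where "m = real (CARD('a) div 2)"
    define P3 where "P3 = 1 / (q - 1) ^ 3"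
    define P2 where "P2 = (1 - 1 / q^3) / (q - 1) *
      ((1 - (1 - 1 / q) * (1 - 1 / q^2)) - 1 / (q - 1)^2)"
    obtain k where k: "n = Suc k" "k \<ge> 2" using n by (cases n) auto
    have "P2 \<le> root_prob n {a, b}" if ab: "a \<noteq> b" for a b :: 'a
    proof -
      have "root_prob k {a, b} \<le> 1 / (q - 1)^2"
        using root_prob_le[of k "{a, b}"] ab by (simp add: q_def power2_eq_square)
      moreover have "1 - (1 - 1 / q) * (1 - 1 / q^2) \<le> root_prob k {b}"
        using root_prob_singleton_mono[OF k(2), of b] by (simp add: root_prob_dim_1_2_3(2) q_def)
      ultimately have d: "(1 - (1 - 1 / q) * (1 - 1 / q^2)) - 1 / (q - 1)^2
          \<le> root_prob k {b} - root_prob k {a, b}" by linarith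
      have "1 / (q - 1)^2 \<le> 1 - (1 - 1 / q) * (1 - 1 / q^2)"
      proof -
        define t where "t = q - 4"
        have t: "t \<ge> 0" "q = t + 4" "q - 1 = t + 3" using q by (auto simp: t_def)
        have "1 - (1 - 1 / q) * (1 - 1 / q^2) - 1 / (q - 1)^2 =
            (t^4 + 14 * t^3 + 70 * t^2 + 147 * t + 107) / (q^3 * (q - 1)^2)"
          unfolding t(3) unfolding t(2) using t(1) 
          by (simp add: divide_simps) (simp add: algebra_simps power_numeral_reduce)
        moreover have "\<dots> \<ge> 0" using t(1) q by simp
        ultimately show ?thesis by linarith
      qed
      moreover have "1 / q ^ n \<le> 1 / q^3"
        using q n by (intro divide_left_mono power_increasing) auto
      ultimately have "P2 \<le> (1 - 1 / q ^ n) / (q - 1) * (root_prob k {b} - root_prob k {a, b})"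
        unfolding P2_def using q d by (intro mult_mono divide_right_mono) auto
      also have "\<dots> \<le> root_prob n {a, b}"
        using root_prob_pair_ge[OF ab, of k] by (simp add: k q_def)
      finally show ?thesis .
    qed
    moreover have "root_prob n T \<le> P3" if "card T = 3" for T :: "'a set"
      using root_prob_le[of n T] that by (simp add: P3_def q_def)
    ultimately have "root_prob n {0 :: 'a} + (m * (P2 - P3) - m * (m - 1) / 2 * P3)
        \<le> prob_nonzero_twisted_centralizer n lam"
      unfolding m_def by (rule prob_nonzero_ge_inclusion_exclusion[OF lam])
    moreover have "m = (q - 1) / 2 \<or> m = q / 2"
      by (cases "even CARD('a)") (auto elim!: evenE oddE simp: m_def q_def)
    then have "5 / 4 * (1 / q) \<le> (1 - (1 - 1 / q) * (1 - 1 / q^2) * (1 - 1 / q^3)) +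
        (m * (P2 - P3) - m * (m - 1) / 2 * P3)"
      unfolding P2_def P3_def by (rule inclusion_exclusion_bound_ge[OF q])
    ultimately show ?thesis using s unfolding q_def by linarith
  qed
qed

theorem theorem5p2:
  fixes lam :: "'a::{field,finite}" and n :: nat
  assumes "n \<ge> 1"
  shows "(lam = 0 \<longrightarrow>
            prob_nonzero_twisted_centralizer n lam \<ge> 1 / real CARD('a)) \<and>
         (lam = 1 \<longrightarrow>
            prob_nonzero_twisted_centralizer n lam = 1) \<and>
         (lam \<notin> {0, 1} \<and> n \<noteq> 1 \<and> n \<noteq> 3 \<longrightarrow>
            prob_nonzero_twisted_centralizer n lam \<ge> 5 / 4 * (1 / real CARD('a))) \<and>
         (lam \<notin> {0, 1} \<and> n = 3 \<longrightarrow>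
            prob_nonzero_twisted_centralizer n lam \<ge> 7 / 6 * (1 / real CARD('a)))"
proof -
  have "1 / real CARD('a) \<le> prob_nonzero_twisted_centralizer n lam"
    using root_prob_singleton_mono[OF assms, of "0 :: 'a"] prob_nonzero_ge_root_prob_0[of n lam]
    by (simp add: root_prob_dim_1_2_3(1))
  moreover have "prob_nonzero_twisted_centralizer n (1 :: 'a) = 1"
  proof -
    have "mat_prob n {A :: 'a mat. True} \<le> mat_prob n {A :: 'a mat. twisted_centralizer n A 1 \<noteq> {0\<^sub>m n n}}"
      using twisted_centralizer_1_nonzero assms by (intro mat_prob_mono) blast
    then show ?thesis unfolding prob_nonzero_twisted_centralizer_def mat_prob_def
      by (intro antisym measure_pmf.prob_le_1) simp
  qed
  moreover have "5 / 4 * (1 / real CARD('a)) \<le> prob_nonzero_twisted_centralizer n lam"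
    if "lam \<notin> {0, 1}" "n \<noteq> 1"
  proof (cases "n = 2")
    case True
    then show ?thesis using prob_nonzero_ge_dim_2[of lam] that by simp
  next
    case False
    then show ?thesis using prob_nonzero_ge_dim_ge_3[of lam n] that assms by simp
  qed
  moreover have "7 / 6 * (1 / real CARD('a)) \<le> 5 / 4 * (1 / real CARD('a))"
    by (intro mult_right_mono) auto
  ultimately show ?thesis by fastforce
qed

end
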